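(* Let $\mathcal{R}$ be a $2$-torsion free commutative ring with identity and let $(X,\le)$ be a finite preordered set. Then each Lie derivation $L$ of the incidence algebra $I(X,\mathcal{R})$ is proper, i.e. $L=D+F$, where $D:I(X,\mathcal{R})\to I(X,\mathcal{R})$ is a derivation and $F:I(X,\mathcal{R})\to I(X,\mathcal{R})$ is an $\mathcal{R}$-linear map whose values lie in the center of $I(X,\mathcal{R})$.
   Context: A preordered set $(X,\le)$ is a set with a reflexive and transitive binary relation $\le$ (antisymmetry is not assumed). A ring $\mathcal{R}$ is $2$-torsion free if $2r=0$ implies $r=0$ for $r\in\mathcal{R}$. The incidence algebra of $X$ over $\mathcal{R}$ is $I(X,\mathcal{R})=\{f:X\times X\to\mathcal{R}\mid f(x,y)=0\text{ if }x\not\le y\}$ with pointwise addition and scalar multiplication, and product $(fg)(x,y)=\sum_{x\le z\le y}f(x,z)g(z,y)$. It is an associative $\mathcal{R}$-algebra with identity. For an associative $\mathcal{R}$-algebra $A$ put $[a,b]=ab-ba$. An $\mathcal{R}$-linear map $D:A\to A$ is a derivation if $D(ab)=D(a)b+aD(b)$ for all $a,b\in A$. An $\mathcal{R}$-linear map $L:A\to A$ is a Lie derivation if $L([a,b])=[L(a),b]+[a,L(b)]$ for all $a,b\in A$. A Lie derivation is proper if it is the sum of a derivation of $A$ and an $\mathcal{R}$-linear map from $A$ to its center. *)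

theory Defs
  imports Main "HOL-Library.Function_Algebras"
begin

text \<open>
  Addition, subtraction and zero of functions are the pointwise ones of
  \<^theory>\<open>HOL-Library.Function_Algebras\<close>; its pointwise product is not used.
  An element of the incidence algebra is stored as a function that is total on the
  ambient type, so it is also required to vanish outside \<open>X\<close>; this makes equality of
  such functions the same as equality on \<open>X\<close>.
\<close>

definition incidence_algebra :: "'a set \<Rightarrow> ('a \<Rightarrow> 'a \<Rightarrow> bool) \<Rightarrow> ('a \<Rightarrow> 'a \<Rightarrow> 'r::comm_ring) set" where
  "incidence_algebra X le = {f. \<forall>x y. \<not> (x \<in> X \<and> y \<in> X \<and> le x y) \<longrightarrow> f x y = 0}"

definition incidence_scale :: "'r::comm_ring \<Rightarrow> ('a \<Rightarrow> 'a \<Rightarrow> 'r) \<Rightarrow> 'a \<Rightarrow> 'a \<Rightarrow> 'r" where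
  "incidence_scale r f = (\<lambda>x y. r * f x y)"

definition incidence_mult ::
  "'a set \<Rightarrow> ('a \<Rightarrow> 'a \<Rightarrow> bool) \<Rightarrow> ('a \<Rightarrow> 'a \<Rightarrow> 'r::comm_ring) \<Rightarrow> ('a \<Rightarrow> 'a \<Rightarrow> 'r) \<Rightarrow> 'a \<Rightarrow> 'a \<Rightarrow> 'r" where
  "incidence_mult X le f g = (\<lambda>x y. \<Sum>z | z \<in> X \<and> le x z \<and> le z y. f x z * g z y)"

text \<open>
  In the following, an associative algebra is given by its carrier \<open>A\<close>, scalar
  multiplication \<open>scale\<close> and product \<open>mul\<close>. Maps are only constrained on \<open>A\<close>.
\<close>

definition linear_endo :: "'b::ab_group_add set \<Rightarrow> ('r \<Rightarrow> 'b \<Rightarrow> 'b) \<Rightarrow> ('b \<Rightarrow> 'b) \<Rightarrow> bool" where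
  "linear_endo A scale L \<longleftrightarrow>
     (\<forall>a\<in>A. L a \<in> A) \<and>
     (\<forall>a\<in>A. \<forall>b\<in>A. L (a + b) = L a + L b) \<and>
     (\<forall>r. \<forall>a\<in>A. L (scale r a) = scale r (L a))"

definition commutator :: "('b::ab_group_add \<Rightarrow> 'b \<Rightarrow> 'b) \<Rightarrow> 'b \<Rightarrow> 'b \<Rightarrow> 'b" where
  "commutator mul a b = mul a b - mul b a"

definition algebra_center :: "'b set \<Rightarrow> ('b \<Rightarrow> 'b \<Rightarrow> 'b) \<Rightarrow> 'b set" where
  "algebra_center A mul = {c \<in> A. \<forall>a\<in>A. mul c a = mul a c}"

definition derivation ::
  "'b::ab_group_add set \<Rightarrow> ('r \<Rightarrow> 'b \<Rightarrow> 'b) \<Rightarrow> ('b \<Rightarrow> 'b \<Rightarrow> 'b) \<Rightarrow> ('b \<Rightarrow> 'b) \<Rightarrow> bool" where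
  "derivation A scale mul D \<longleftrightarrow>
     linear_endo A scale D \<and>
     (\<forall>a\<in>A. \<forall>b\<in>A. D (mul a b) = mul (D a) b + mul a (D b))"

definition lie_derivation ::
  "'b::ab_group_add set \<Rightarrow> ('r \<Rightarrow> 'b \<Rightarrow> 'b) \<Rightarrow> ('b \<Rightarrow> 'b \<Rightarrow> 'b) \<Rightarrow> ('b \<Rightarrow> 'b) \<Rightarrow> bool" where
  "lie_derivation A scale mul L \<longleftrightarrow>
     linear_endo A scale L \<and>
     (\<forall>a\<in>A. \<forall>b\<in>A. L (commutator mul a b) =
        commutator mul (L a) b + commutator mul a (L b))"

definition proper_lie_derivation ::
  "'b::ab_group_add set \<Rightarrow> ('r \<Rightarrow> 'b \<Rightarrow> 'b) \<Rightarrow> ('b \<Rightarrow> 'b \<Rightarrow> 'b) \<Rightarrow> ('b \<Rightarrow> 'b) \<Rightarrow> bool" where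
  "proper_lie_derivation A scale mul L \<longleftrightarrow>
     lie_derivation A scale mul L \<and>
     (\<exists>D F. derivation A scale mul D \<and>
            linear_endo A scale F \<and> (\<forall>a\<in>A. F a \<in> algebra_center A mul) \<and>
            (\<forall>a\<in>A. L a = D a + F a))"

end

theory Submission imports Defs begin

text \<open>
  After subtracting an inner derivation, \<open>L\<close> sends every diagonal idempotent
  \<open>matrix_unit x x\<close> to a diagonal element (\<open>diagonalizing_inner_derivation\<close>). The eigenvector
  equations \<open>bracket (matrix_unit x x) (matrix_unit x y) = matrix_unit x y\<close> and
  \<open>bracket (matrix_unit x y) (matrix_unit y y) = matrix_unit x y\<close>, for \<open>x \<noteq> y\<close>, then leave very little
  freedom: \<open>L\<close> multiplies \<open>matrix_unit x y\<close> by a scalar \<open>weight x y\<close>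
  (\<open>L_matrix_unit_support\<close>; 2-torsion freeness excludes a component along
  \<open>matrix_unit y x\<close>), and the diagonal idempotents have central images
  (\<open>L_diagonal_unit_central\<close>).

  With value \<open>0\<close> on the diagonal, the weights form an additive cocycle on the preorder
  (\<open>weight_cocycle\<close>), so entrywise multiplication by them is a derivation
  (\<open>derivation_hadamard\<close>). What remains of \<open>L\<close> after removing this second derivation takes
  diagonal values with equal entries at comparable points (\<open>L_minus_hadamard_central\<close>); these
  are exactly the central elements (\<open>center_iff\<close>).

  The entries of \<open>L f\<close> are computed by bracketing \<open>f\<close> with one or two matrix units, so \<open>f\<close>
  is never expanded as a linear combination of them.
\<close>

section \<open>The incidence algebra of a finite preordered set\<close>

definition matrix_unit :: "'a \<Rightarrow> 'a \<Rightarrow> 'a \<Rightarrow> 'a \<Rightarrow> 'r::{comm_ring, comm_monoid_mult}" where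
  "matrix_unit x y = (\<lambda>u v. if u = x \<and> v = y then 1 else 0)"

definition hadamard :: "('a \<Rightarrow> 'a \<Rightarrow> 'r) \<Rightarrow> ('a \<Rightarrow> 'a \<Rightarrow> 'r) \<Rightarrow> 'a \<Rightarrow> 'a \<Rightarrow> 'r::comm_ring" where
  "hadamard c f = (\<lambda>u v. c u v * f u v)"

locale finite_preorder =
  fixes X :: "'a set" and le :: "'a \<Rightarrow> 'a \<Rightarrow> bool" (infix "\<preceq>" 50)
  assumes finite_X: "finite X"
    and refl_le: "reflp_on X le"
    and trans_le: "transp_on X le"
begin

abbreviation A :: "('a \<Rightarrow> 'a \<Rightarrow> 'r::comm_ring) set" where
  "A \<equiv> incidence_algebra X le"

abbreviation mult :: "('a \<Rightarrow> 'a \<Rightarrow> 'r::comm_ring) \<Rightarrow> ('a \<Rightarrow> 'a \<Rightarrow> 'r) \<Rightarrow> 'a \<Rightarrow> 'a \<Rightarrow> 'r"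
    (infixl "\<star>" 70) where
  "f \<star> g \<equiv> incidence_mult X le f g"

abbreviation bracket :: "('a \<Rightarrow> 'a \<Rightarrow> 'r::comm_ring) \<Rightarrow> ('a \<Rightarrow> 'a \<Rightarrow> 'r) \<Rightarrow> 'a \<Rightarrow> 'a \<Rightarrow> 'r" where
  "bracket \<equiv> commutator (incidence_mult X le)"

lemma le_refl: "x \<in> X \<Longrightarrow> x \<preceq> x"
  using refl_le by (rule reflp_onD)

lemma le_trans: "x \<in> X \<Longrightarrow> y \<in> X \<Longrightarrow> z \<in> X \<Longrightarrow> x \<preceq> y \<Longrightarrow> y \<preceq> z \<Longrightarrow> x \<preceq> z"
  using trans_le by (rule transp_onD)

lemma incidence_zero: "f \<in> A \<Longrightarrow> \<not> (x \<in> X \<and> y \<in> X \<and> x \<preceq> y) \<Longrightarrow> f x y = 0"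
  by (auto simp: incidence_algebra_def)

lemma zero_closed: "0 \<in> A"
  and add_closed: "f \<in> A \<Longrightarrow> g \<in> A \<Longrightarrow> f + g \<in> A"
  and diff_closed: "f \<in> A \<Longrightarrow> g \<in> A \<Longrightarrow> f - g \<in> A"
  and hadamard_closed: "f \<in> A \<Longrightarrow> hadamard c f \<in> A"
  by (simp_all add: incidence_algebra_def hadamard_def)

lemma matrix_unit_closed: "x \<in> X \<Longrightarrow> y \<in> X \<Longrightarrow> x \<preceq> y \<Longrightarrow> matrix_unit x y \<in> A"
  by (auto simp: incidence_algebra_def matrix_unit_def)

text \<open>The summands with \<open>z\<close> outside the interval from \<open>x\<close> to \<open>y\<close> vanish, so the convolution is
  matrix multiplication with rows and columns indexed by \<open>X\<close>.\<close>

lemma mult_eq_sum: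
  assumes "f \<in> A" "g \<in> A"
  shows "(f \<star> g) x y = (\<Sum>z\<in>X. f x z * g z y)"
  unfolding incidence_mult_def
proof (rule sum.mono_neutral_left)
  show "\<forall>z\<in>X - {z \<in> X. x \<preceq> z \<and> z \<preceq> y}. f x z * g z y = 0"
  proof (rule ballI)
    fix z assume "z \<in> X - {z \<in> X. x \<preceq> z \<and> z \<preceq> y}"
    then show "f x z * g z y = 0"
      using incidence_zero[OF assms(1), of x z] incidence_zero[OF assms(2), of z y] by auto
  qed
qed (use finite_X in auto)

lemma mult_closed:
  assumes "f \<in> A" "g \<in> A"
  shows "f \<star> g \<in> A"
proof -
  have "(f \<star> g) x y = 0" if "\<not> (x \<in> X \<and> y \<in> X \<and> x \<preceq> y)" for x y
    unfolding mult_eq_sum[OF assms]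
  proof (rule sum.neutral, rule ballI)
    fix z assume "z \<in> X"
    then have "\<not> (x \<in> X \<and> z \<in> X \<and> x \<preceq> z) \<or> \<not> (z \<in> X \<and> y \<in> X \<and> z \<preceq> y)"
      using that le_trans by blast
    then show "f x z * g z y = 0"
      using incidence_zero[OF assms(1), of x z] incidence_zero[OF assms(2), of z y] by auto
  qed
  then show ?thesis by (auto simp: incidence_algebra_def)
qed

lemma mult_add_left: "(f + g) \<star> h = f \<star> h + g \<star> h"
  and mult_add_right: "h \<star> (f + g) = h \<star> f + h \<star> g"
  and mult_diff_left: "(f - g) \<star> h = f \<star> h - g \<star> h"
  and mult_diff_right: "h \<star> (f - g) = h \<star> f - h \<star> g"
  by (simp_all add: incidence_mult_def fun_eq_iff distrib_left distrib_right
      left_diff_distrib right_diff_distrib sum.distrib sum_subtractf)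

lemma mult_scale_left: "incidence_scale r f \<star> h = incidence_scale r (f \<star> h)"
  and mult_scale_right: "h \<star> incidence_scale r f = incidence_scale r (h \<star> f)"
  by (simp_all add: incidence_mult_def incidence_scale_def fun_eq_iff sum_distrib_left mult_ac)

lemma scale_diff: "incidence_scale r (f - g) = incidence_scale r f - incidence_scale r g"
  by (auto simp: incidence_scale_def fun_eq_iff algebra_simps)

lemma mult_assoc:
  assumes "f \<in> A" "g \<in> A" "h \<in> A"
  shows "f \<star> g \<star> h = f \<star> (g \<star> h)"
proof (intro ext)
  fix x y
  have "(f \<star> g \<star> h) x y = (\<Sum>z\<in>X. \<Sum>w\<in>X. f x w * g w z * h z y)"
    using assms by (simp add: mult_eq_sum mult_closed sum_distrib_right)
  also have "\<dots> = (\<Sum>w\<in>X. \<Sum>z\<in>X. f x w * g w z * h z y)"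
    by (rule sum.swap)
  also have "\<dots> = (f \<star> (g \<star> h)) x y"
    using assms by (simp add: mult_eq_sum mult_closed sum_distrib_left mult.assoc)
  finally show "(f \<star> g \<star> h) x y = (f \<star> (g \<star> h)) x y" .
qed

lemma bracket_closed: "f \<in> A \<Longrightarrow> g \<in> A \<Longrightarrow> bracket f g \<in> A"
  by (simp add: commutator_def mult_closed diff_closed)

lemma mult_matrix_unit:
  assumes "f \<in> A" "x \<in> X" "y \<in> X" "x \<preceq> y"
  shows "(f \<star> matrix_unit x y) u v = (if v = y then f u x else 0)"
proof -
  have "(f \<star> matrix_unit x y) u v = (\<Sum>z\<in>X. if z = x then (if v = y then f u x else 0) else 0)"
    unfolding mult_eq_sum[OF assms(1) matrix_unit_closed[OF assms(2-4)]]
    by (rule sum.cong) (auto simp: matrix_unit_def)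
  then show ?thesis using assms finite_X by simp
qed

lemma matrix_unit_mult:
  assumes "f \<in> A" "x \<in> X" "y \<in> X" "x \<preceq> y"
  shows "(matrix_unit x y \<star> f) u v = (if u = x then f y v else 0)"
proof -
  have "(matrix_unit x y \<star> f) u v = (\<Sum>z\<in>X. if z = y then (if u = x then f y v else 0) else 0)"
    unfolding mult_eq_sum[OF matrix_unit_closed[OF assms(2-4)] assms(1)]
    by (rule sum.cong) (auto simp: matrix_unit_def)
  then show ?thesis using assms finite_X by simp
qed

lemma bracket_matrix_unit:
  assumes "f \<in> A" "x \<in> X" "y \<in> X" "x \<preceq> y"
  shows "bracket f (matrix_unit x y) u v =
           (if v = y then f u x else 0) - (if u = x then f y v else 0)"
    and "bracket (matrix_unit x y) f u v =
           (if u = x then f y v else 0) - (if v = y then f u x else 0)"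
  by (simp_all add: commutator_def mult_matrix_unit[OF assms] matrix_unit_mult[OF assms])

lemma bracket_matrix_units:
  assumes "x \<in> X" "y \<in> X" "x \<preceq> y" "z \<in> X" "w \<in> X" "z \<preceq> w"
  shows "bracket (matrix_unit x y) (matrix_unit z w) =
           (if y = z then matrix_unit x w else 0) - (if x = w then matrix_unit z y else 0)"
proof (intro ext)
  fix u v
  show "bracket (matrix_unit x y) (matrix_unit z w) u v =
      ((if y = z then matrix_unit x w else 0) - (if x = w then matrix_unit z y else 0)) u v"
    unfolding bracket_matrix_unit(2)[OF matrix_unit_closed[OF assms(4-6)] assms(1-3)]
    by (auto simp: matrix_unit_def)
qed

text \<open>Commuting with all matrix units forces a function to be diagonal and to take equal
  values at comparable points, so the center consists of the diagonal functions that are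
  constant on the connected components of the preorder.\<close>

lemma center_iff:
  fixes f :: "'a \<Rightarrow> 'a \<Rightarrow> 'r::{comm_ring, comm_monoid_mult}"
  shows "f \<in> algebra_center A (incidence_mult X le) \<longleftrightarrow>
     f \<in> A \<and> (\<forall>u v. u \<noteq> v \<longrightarrow> f u v = 0) \<and>
     (\<forall>u\<in>X. \<forall>v\<in>X. u \<preceq> v \<longrightarrow> f u u = f v v)"
  (is "?central \<longleftrightarrow> ?diag")
proof
  assume ?central
  then have f: "f \<in> A" and comm: "\<And>g. g \<in> A \<Longrightarrow> bracket f g = 0"
    by (simp_all add: algebra_center_def commutator_def)
  have "f u v = 0" if "u \<noteq> v" for u v
  proof (cases "u \<in> X")
    case True
    have "bracket f (matrix_unit u u) u v = 0"
      using comm[OF matrix_unit_closed] True le_refl by (simp add: fun_eq_iff)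
    then show ?thesis
      using that True le_refl by (simp add: bracket_matrix_unit[OF f])
  qed (simp add: incidence_zero[OF f])
  moreover have "f u u = f v v" if "u \<in> X" "v \<in> X" "u \<preceq> v" for u v
  proof -
    have "bracket f (matrix_unit u v) u v = 0"
      using comm[OF matrix_unit_closed] that by (simp add: fun_eq_iff)
    then show ?thesis using that by (simp add: bracket_matrix_unit[OF f])
  qed
  ultimately show ?diag using f by blast
next
  assume ?diag
  then have f: "f \<in> A" and off: "\<And>u v. u \<noteq> v \<Longrightarrow> f u v = 0"
    and const: "\<And>u v. u \<in> X \<Longrightarrow> v \<in> X \<Longrightarrow> u \<preceq> v \<Longrightarrow> f u u = f v v" by auto
  have "(f \<star> g) u v = (g \<star> f) u v" if g: "g \<in> A" for g u v
  proof (cases "u \<in> X \<and> v \<in> X \<and> u \<preceq> v")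
    case True
    have "(f \<star> g) u v = (\<Sum>z\<in>X. if z = u then f u u * g u v else 0)"
      unfolding mult_eq_sum[OF f g] by (rule sum.cong) (auto simp: off)
    moreover have "(g \<star> f) u v = (\<Sum>z\<in>X. if z = v then g u v * f v v else 0)"
      unfolding mult_eq_sum[OF g f] by (rule sum.cong) (auto simp: off)
    ultimately show ?thesis
      using True const[of u v] finite_X by (simp add: mult.commute)
  next
    case False
    then show ?thesis
      using incidence_zero[OF mult_closed[OF f g]] incidence_zero[OF mult_closed[OF g f]] by simp
  qed
  then show ?central using f by (auto simp: algebra_center_def fun_eq_iff)
qed

section \<open>Derivations\<close>

lemma derivation_inner:
  assumes "b \<in> A"
  shows "derivation A incidence_scale (incidence_mult X le) (bracket b)"
  using assms
  by (auto simp: derivation_def linear_endo_def bracket_closed)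
     (simp_all add: commutator_def mult_add_left mult_add_right mult_scale_left mult_scale_right
       scale_diff mult_diff_left mult_diff_right mult_assoc)

text \<open>Rescaling the entries by an additive cocycle multiplies every summand
  \<open>f x z * g z y\<close> of a product by the same factor \<open>c x y = c x z + c z y\<close>, which is the Leibniz
  rule.\<close>

lemma derivation_hadamard:
  assumes cocycle: "\<And>x y z. x \<in> X \<Longrightarrow> y \<in> X \<Longrightarrow> z \<in> X \<Longrightarrow> x \<preceq> y \<Longrightarrow> y \<preceq> z \<Longrightarrow>
    c x z = c x y + c y z"
  shows "derivation A incidence_scale (incidence_mult X le) (hadamard c)"
proof -
  have "hadamard c (f \<star> g) u v = (hadamard c f \<star> g + f \<star> hadamard c g) u v"
    if fg: "f \<in> A" "g \<in> A" for f g u v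
  proof -
    have entry: "c u v * (f u z * g z v) = c u z * f u z * g z v + f u z * (c z v * g z v)"
      for z
    proof (cases "f u z = 0 \<or> g z v = 0")
      case False
      then have "c u v = c u z + c z v"
        using cocycle incidence_zero[OF fg(1)] incidence_zero[OF fg(2)] by blast
      then show ?thesis by (simp add: algebra_simps)
    qed auto
    show ?thesis
      using fg
      by (simp add: mult_eq_sum hadamard_closed hadamard_def[of c "f \<star> g"] sum_distrib_left
          entry sum.distrib) (simp add: hadamard_def)
  qed
  then show ?thesis
    by (auto simp: derivation_def linear_endo_def hadamard_closed fun_eq_iff)
       (auto simp: hadamard_def incidence_scale_def algebra_simps)
qed

lemma linear_endo_add:
  assumes "linear_endo A incidence_scale L" "linear_endo A incidence_scale M"
  shows "linear_endo A incidence_scale (\<lambda>a. L a + M a)"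
  using assms by (auto simp: linear_endo_def add_closed)
     (auto simp: incidence_scale_def fun_eq_iff algebra_simps)

lemma linear_endo_diff:
  assumes "linear_endo A incidence_scale L" "linear_endo A incidence_scale M"
  shows "linear_endo A incidence_scale (\<lambda>a. L a - M a)"
  using assms by (auto simp: linear_endo_def diff_closed scale_diff)

lemma derivation_add:
  assumes "derivation A incidence_scale (incidence_mult X le) D"
    "derivation A incidence_scale (incidence_mult X le) E"
  shows "derivation A incidence_scale (incidence_mult X le) (\<lambda>a. D a + E a)"
  using assms by (auto simp: derivation_def linear_endo_add mult_add_left mult_add_right)

lemma lie_derivation_diff:
  assumes "lie_derivation A incidence_scale (incidence_mult X le) L"
    and D: "derivation A incidence_scale (incidence_mult X le) D"
  shows "lie_derivation A incidence_scale (incidence_mult X le) (\<lambda>a. L a - D a)"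
proof -
  have D_diff: "D (f - g) = D f - D g" if "f \<in> A" "g \<in> A" for f g
  proof -
    have "D (f - g + g) = D (f - g) + D g"
      using D that diff_closed[OF that] unfolding derivation_def linear_endo_def by blast
    then show ?thesis by simp
  qed
  have "D (bracket f g) = bracket (D f) g + bracket f (D g)" if "f \<in> A" "g \<in> A" for f g
    using D that by (simp add: derivation_def commutator_def D_diff mult_closed)
  with assms show ?thesis
    by (auto simp: lie_derivation_def derivation_def linear_endo_diff)
       (simp add: commutator_def mult_diff_left mult_diff_right)
qed

end

section \<open>Lie derivations that make the diagonal idempotents diagonal\<close>

locale diagonal_lie_derivation = finite_preorder X le
  for X :: "'a set" and le (infix "\<preceq>" 50) +
  fixes L :: "('a \<Rightarrow> 'a \<Rightarrow> 'r::{comm_ring, comm_monoid_mult}) \<Rightarrow> ('a \<Rightarrow> 'a \<Rightarrow> 'r)"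
  assumes two_torsion_free: "\<And>r::'r. r + r = 0 \<Longrightarrow> r = 0"
    and lie: "lie_derivation (incidence_algebra X le) incidence_scale (incidence_mult X le) L"
    and diagonal: "\<And>x u v. x \<in> X \<Longrightarrow> u \<noteq> v \<Longrightarrow> L (matrix_unit x x) u v = 0"
begin

abbreviation E :: "'a \<Rightarrow> 'a \<Rightarrow> 'a \<Rightarrow> 'a \<Rightarrow> 'r" where
  "E \<equiv> matrix_unit"

lemma L_closed: "f \<in> A \<Longrightarrow> L f \<in> A"
  and L_add: "f \<in> A \<Longrightarrow> g \<in> A \<Longrightarrow> L (f + g) = L f + L g"
  and L_scale: "f \<in> A \<Longrightarrow> L (incidence_scale r f) = incidence_scale r (L f)"
  and L_bracket: "f \<in> A \<Longrightarrow> g \<in> A \<Longrightarrow> L (bracket f g) = bracket (L f) g + bracket f (L g)"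
  using lie by (auto simp: lie_derivation_def linear_endo_def)

lemma eq_neg_imp_zero: "r = - r \<Longrightarrow> r = 0" for r :: 'r
  using two_torsion_free[of r] by (metis add.left_inverse)

lemma L_zero: "L 0 = 0"
  using L_add[of 0 0] zero_closed by simp

lemma L_diff:
  assumes "f \<in> A" "g \<in> A"
  shows "L (f - g) = L f - L g"
proof -
  have "L (f - g + g) = L (f - g) + L g" by (rule L_add[OF diff_closed[OF assms] assms(2)])
  then show ?thesis by simp
qed

text \<open>For \<open>x \<noteq> y\<close>, \<open>E x y\<close> is an eigenvector of bracketing with both
  \<open>E x x\<close> and \<open>E y y\<close>. As \<open>L\<close> maps these two to diagonal elements, the image
  of \<open>E x y\<close> satisfies the same two eigenvector equations up to a multiple of
  \<open>E x y\<close>. Outside the position \<open>(x, y)\<close> they leave only the condition \<open>c = - c\<close> on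
  the entry at \<open>(y, x)\<close>.\<close>

lemma L_matrix_unit_support:
  assumes xy: "x \<in> X" "y \<in> X" "x \<preceq> y" "x \<noteq> y" and uv: "\<not> (u = x \<and> v = y)"
  shows "L (E x y) u v = 0"
proof -
  note e = matrix_unit_closed[OF xy(1-3)]
  have ex: "E x x \<in> A" and ey: "E y y \<in> A"
    using xy le_refl matrix_unit_closed by auto
  let ?c = "L (E x y)"
  have "bracket (E x x) (E x y) = E x y"
    using xy by (simp add: bracket_matrix_units le_refl)
  then have "?c = bracket (L (E x x)) (E x y) + bracket (E x x) ?c"
    using L_bracket[OF ex e] by simp
  then have 1: "?c u v = (if u = x then ?c x v else 0) - (if v = x then ?c u x else 0)"
    using xy uv le_refl diagonal[OF xy(1)]
    by (auto simp: fun_eq_iff bracket_matrix_unit[OF L_closed[OF ex]]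
        bracket_matrix_unit[OF L_closed[OF e]] split: if_splits)
  have "bracket (E x y) (E y y) = E x y"
    using xy by (simp add: bracket_matrix_units le_refl)
  then have "?c = bracket ?c (E y y) + bracket (E x y) (L (E y y))"
    using L_bracket[OF e ey] by simp
  then have 2: "?c u v = (if v = y then ?c u y else 0) - (if u = y then ?c y v else 0)"
    using xy uv le_refl diagonal[OF xy(2)]
    by (auto simp: fun_eq_iff bracket_matrix_unit[OF L_closed[OF ey]]
        bracket_matrix_unit[OF L_closed[OF e]] split: if_splits)
  show ?thesis
    using 1 2 uv xy(4) eq_neg_imp_zero[of "?c u v"] by (auto split: if_splits)
qed

text \<open>If \<open>u \<preceq> v\<close> and \<open>u \<noteq> v\<close>, then \<open>E u v\<close> is an eigenvector of bracketing with \<open>E z z\<close>, and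
  its image is a multiple of it. Hence in the Lie rule for \<open>bracket (E z z) (E u v)\<close> the entry
  at \<open>(u, v)\<close> of \<open>bracket (L (E z z)) (E u v)\<close>, the difference of two diagonal entries of
  \<open>L (E z z)\<close>, has to vanish.\<close>

lemma L_diagonal_unit_central:
  assumes z: "z \<in> X"
  shows "L (E z z) \<in> algebra_center A (incidence_mult X le)"
proof -
  have ez: "E z z \<in> A" using z le_refl matrix_unit_closed by auto
  let ?d = "L (E z z)"
  have "?d u u = ?d v v" if uv: "u \<in> X" "v \<in> X" "u \<preceq> v" "u \<noteq> v" for u v
  proof -
    note e = matrix_unit_closed[OF uv(1-3)]
    let ?c = "L (E u v)"
    have eq: "L (bracket (E z z) (E u v)) u v =
        ?d u u - ?d v v + bracket (E z z) ?c u v"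
      using L_bracket[OF ez e] uv by (simp add: bracket_matrix_unit[OF L_closed[OF ez]])
    have br: "bracket (E z z) f u v =
        (if u = z then f z v else 0) - (if v = z then f u z else 0)" if "f \<in> A" for f
      using z le_refl by (simp add: bracket_matrix_unit[OF that])
    consider "z = u" | "z = v" | "z \<noteq> u" "z \<noteq> v" by blast
    then show ?thesis
    proof cases
      case 1
      then have "bracket (E z z) (E u v) = E u v"
        using uv z by (simp add: bracket_matrix_units le_refl)
      then show ?thesis using eq br[OF L_closed[OF e]] 1 uv by simp
    next
      case 2
      then have "bracket (E z z) (E u v) = 0 - E u v"
        using uv z by (simp add: bracket_matrix_units le_refl)
      then show ?thesis
        using eq br[OF L_closed[OF e]] 2 uv
        by (simp add: L_diff[OF zero_closed e, simplified] L_zero)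
    next
      case 3
      then have "bracket (E z z) (E u v) = 0"
        using uv z by (simp add: bracket_matrix_units le_refl)
      then show ?thesis using eq br[OF L_closed[OF e]] 3 uv by (simp add: L_zero)
    qed
  qed
  then show ?thesis
    unfolding center_iff using L_closed[OF ez] diagonal[OF z] by metis
qed

text \<open>The value \<open>0\<close> on the diagonal is forced by the cocycle identity \<open>weight_cocycle\<close>; the
  diagonal entries of \<open>L (E x x)\<close> belong to the central part of \<open>L\<close>.\<close>

definition weight :: "'a \<Rightarrow> 'a \<Rightarrow> 'r" where
  "weight x y = (if x = y then 0 else L (E x y) x y)"

lemma L_scaled_matrix_unit:
  assumes f: "f \<in> A" and xy: "x \<in> X" "y \<in> X" "x \<noteq> y"
  shows "L (incidence_scale (f x y) (E x y)) u v =
    (if u = x \<and> v = y then weight x y * f x y else 0)"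
proof (cases "x \<preceq> y")
  case True
  then show ?thesis
    using L_scale[OF matrix_unit_closed[OF xy(1,2) True]] xy(3)
      L_matrix_unit_support[OF xy(1,2) True xy(3)]
    by (auto simp: incidence_scale_def weight_def mult.commute)
next
  case False
  then have "f x y = 0" using incidence_zero[OF f] by blast
  moreover then have "incidence_scale (f x y) (E x y) = 0"
    by (simp add: incidence_scale_def fun_eq_iff)
  ultimately show ?thesis by (simp add: L_zero)
qed

text \<open>Because the diagonal idempotents have central images, \<open>L\<close> commutes with bracketing by them.
  Bracketing \<open>f\<close> with the idempotents at \<open>u\<close> and \<open>v\<close> leaves only the entries of \<open>f\<close> at \<open>(u, v)\<close>
  and \<open>(v, u)\<close>, so these alone determine the entry of \<open>L f\<close> at \<open>(u, v)\<close>.\<close>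

lemma L_off_diagonal:
  assumes f: "f \<in> A" and "u \<noteq> v"
  shows "L f u v = weight u v * f u v"
proof (cases "u \<in> X \<and> v \<in> X")
  case True
  then have uv: "u \<in> X" "v \<in> X" by auto
  have closed: "E z z \<in> A" if "z \<in> X" for z
    using that le_refl matrix_unit_closed by auto
  have L_br: "L (bracket (E z z) g) = bracket (E z z) (L g)"
    if "z \<in> X" "g \<in> A" for z g
    using L_bracket[OF closed[OF that(1)] that(2)] L_diagonal_unit_central[OF that(1)] that(2)
    by (simp add: algebra_center_def commutator_def)
  define g where "g = bracket (E u u) (bracket (E v v) f)"
  have bvf: "bracket (E v v) f \<in> A" by (rule bracket_closed[OF closed[OF uv(2)] f])
  have br: "bracket (E z z) h s t =
      (if s = z then h z t else 0) - (if t = z then h s z else 0)"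
    if "z \<in> X" "h \<in> A" for z h s t
    using that le_refl by (simp add: bracket_matrix_unit)
  \<comment> \<open>The two brackets pick up the entry at \<open>(u, v)\<close> with opposite signs, whence the negation.\<close>
  have g: "0 - g = incidence_scale (f u v) (E u v) + incidence_scale (f v u) (E v u)"
    unfolding g_def using assms(2)
    by (simp add: fun_eq_iff br[OF uv(1) bvf] br[OF uv(2) f])
       (auto simp: incidence_scale_def matrix_unit_def)
  have scaled: "incidence_scale (f x y) (E x y) \<in> A" for x y
    using incidence_zero[OF f, of x y]
    by (auto simp: incidence_algebra_def incidence_scale_def matrix_unit_def)
  have gA: "g \<in> A" unfolding g_def by (rule bracket_closed[OF closed[OF uv(1)] bvf])
  have "- L g u v = L (0 - g) u v" by (simp only: L_diff[OF zero_closed gA] L_zero) simp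
  also have "\<dots> = weight u v * f u v"
    unfolding g L_add[OF scaled scaled] using assms(2) uv
    by (simp add: L_scaled_matrix_unit[OF f])
  finally have "- L g u v = weight u v * f u v" .
  moreover have "L g = bracket (E u u) (bracket (E v v) (L f))"
    unfolding g_def by (simp add: L_br uv bvf f)
  then have "L g u v = - L f u v"
    using assms(2) by (simp add: br uv bracket_closed closed L_closed f)
  ultimately show ?thesis by simp
next
  case False
  then show ?thesis
    using incidence_zero[OF f, of u v] incidence_zero[OF L_closed[OF f], of u v] by auto
qed

text \<open>For distinct points, compare the entries at \<open>(x, z)\<close> in the image of
  \<open>bracket (E x y) (E y z) = E x z\<close>. If \<open>x = z \<noteq> y\<close>, this bracket
  is instead the difference of two diagonal idempotents. Its image has equal diagonal entries at
  \<open>x\<close> and \<open>y\<close>, being central, but by the Lie rule they are \<open>weight x y + weight y x\<close> and its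
  negative, so this sum vanishes.\<close>

lemma weight_cocycle:
  assumes xyz: "x \<in> X" "y \<in> X" "z \<in> X" and le: "x \<preceq> y" "y \<preceq> z"
  shows "weight x z = weight x y + weight y z"
proof (cases "x = y \<or> y = z")
  case False
  have exy: "E x y \<in> A" and eyz: "E y z \<in> A"
    using matrix_unit_closed xyz le by auto
  have rule: "L (bracket (E x y) (E y z)) s t =
      (if t = z then L (E x y) s y else 0) - (if s = y then L (E x y) z t else 0)
      + ((if s = x then L (E y z) y t else 0)
         - (if t = y then L (E y z) s x else 0))" for s t
    using L_bracket[OF exy eyz]
    by (simp add: bracket_matrix_unit(1)[OF L_closed[OF exy] xyz(2,3) le(2)]
        bracket_matrix_unit(2)[OF L_closed[OF eyz] xyz(1,2) le(1)])
  show ?thesis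
  proof (cases "x = z")
    case True
    have exx: "E x x \<in> A" and eyy: "E y y \<in> A"
      using matrix_unit_closed xyz le_refl by auto
    have "bracket (E x y) (E y z) = E x x - E y y"
      using xyz le True False by (simp add: bracket_matrix_units)
    then have "L (bracket (E x y) (E y z)) =
        L (E x x) - L (E y y)"
      by (simp add: L_diff[OF exx eyy])
    moreover have "L (E w w) x x = L (E w w) y y" if "w \<in> X" for w
      using L_diagonal_unit_central[OF that] xyz le unfolding center_iff by blast
    ultimately have "L (bracket (E x y) (E y z)) x x =
        L (bracket (E x y) (E y z)) y y"
      using xyz by simp
    then have "(weight x y + weight y x) + (weight x y + weight y x) = 0"
      unfolding rule using True False by (simp add: weight_def algebra_simps)
    then have "weight x y + weight y x = 0"
      by (rule two_torsion_free)
    then show ?thesis using True by (simp add: weight_def)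
  next
    case distinct: False
    have "bracket (E x y) (E y z) = E x z"
      using xyz le False distinct by (simp add: bracket_matrix_units)
    with rule[of x z] False distinct show ?thesis by (auto simp: weight_def)
  qed
qed (auto simp: weight_def)

text \<open>The off-diagonal entries of the difference vanish by construction. That its diagonal is
  constant along \<open>u \<preceq> v\<close> follows by evaluating the image of \<open>bracket f (E u v)\<close> at
  \<open>(u, v)\<close> once with the Lie rule and once with the formula for off-diagonal entries.\<close>

lemma L_minus_hadamard_central:
  assumes f: "f \<in> A"
  shows "L f - hadamard weight f \<in> algebra_center A (incidence_mult X le)"
proof -
  have "L f u u = L f v v" if uv: "u \<in> X" "v \<in> X" "u \<preceq> v" "u \<noteq> v" for u v
  proof -
    note e = matrix_unit_closed[OF uv(1-3)]
    have "L (bracket f (E u v)) u v = weight u v * (f u u - f v v)"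
      using uv by (simp add: L_off_diagonal[OF bracket_closed[OF f e]] bracket_matrix_unit[OF f])
    moreover have "bracket f (L (E u v)) u v = f u u * weight u v - weight u v * f v v"
    proof -
      have "L (E u v) = incidence_scale (weight u v) (E u v)"
        using L_matrix_unit_support[OF uv] uv(4)
        by (auto simp: fun_eq_iff incidence_scale_def matrix_unit_def weight_def)
      then have "bracket f (L (E u v)) =
          incidence_scale (weight u v) (bracket f (E u v))"
        by (simp add: commutator_def mult_scale_left mult_scale_right scale_diff)
      then show ?thesis
        using uv by (simp add: bracket_matrix_unit[OF f] incidence_scale_def algebra_simps)
    qed
    ultimately show ?thesis
      using L_bracket[OF f e] uv
      by (simp add: bracket_matrix_unit[OF L_closed[OF f]] algebra_simps)
  qed
  then have "\<forall>u\<in>X. \<forall>v\<in>X. u \<preceq> v \<longrightarrow> L f u u = L f v v" by metis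
  then show ?thesis
    unfolding center_iff using diff_closed[OF L_closed[OF f] hadamard_closed[OF f]]
    by (simp add: L_off_diagonal[OF f] hadamard_def weight_def)
qed

end

section \<open>Reduction to diagonal images of the diagonal idempotents\<close>

context finite_preorder
begin

text \<open>The matrix \<open>b\<close> is read off from the images of the diagonal idempotents: since these
  idempotents commute, the image of the one at \<open>x\<close> has no off-diagonal entries outside row and
  column \<open>x\<close>, and at the position \<open>(x, v)\<close> the images of the idempotents at \<open>x\<close> and \<open>v\<close> have
  opposite entries. So column \<open>v\<close> of the image of the idempotent at \<open>v\<close> serves as column \<open>v\<close>
  of \<open>b\<close>.\<close>

lemma diagonalizing_inner_derivation:
  fixes L :: "('a \<Rightarrow> 'a \<Rightarrow> 'r::{comm_ring, comm_monoid_mult}) \<Rightarrow> ('a \<Rightarrow> 'a \<Rightarrow> 'r)"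
  assumes lie: "lie_derivation A incidence_scale (incidence_mult X le) L"
  obtains b where "b \<in> A"
    and "\<And>x u v. x \<in> X \<Longrightarrow> u \<noteq> v \<Longrightarrow> L (matrix_unit x x) u v = bracket b (matrix_unit x x) u v"
proof
  let ?E = "matrix_unit :: 'a \<Rightarrow> 'a \<Rightarrow> 'a \<Rightarrow> 'a \<Rightarrow> 'r"
  have closed: "?E x x \<in> A" if "x \<in> X" for x
    using that le_refl matrix_unit_closed by auto
  have L_closed: "L (?E x x) \<in> A" if "x \<in> X" for x
    using lie closed[OF that] by (simp add: lie_derivation_def linear_endo_def)
  have L0: "L 0 = 0"
  proof -
    have "L (0 + 0) = L 0 + L 0"
      using lie zero_closed unfolding lie_derivation_def linear_endo_def by blast
    then show ?thesis by simp
  qed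
  have commute: "(if t = y then L (?E x x) s y else 0)
      - (if s = y then L (?E x x) y t else 0)
      + ((if s = x then L (?E y y) x t else 0)
         - (if t = x then L (?E y y) s x else 0)) = 0"
    if xy: "x \<in> X" "y \<in> X" "x \<noteq> y" for x y t s
  proof -
    have "bracket (?E x x) (?E y y) = 0"
      using xy by (simp add: bracket_matrix_units le_refl)
    then have "bracket (L (?E x x)) (?E y y)
        + bracket (?E x x) (L (?E y y)) = 0"
      using lie closed[OF xy(1)] closed[OF xy(2)] L0 unfolding lie_derivation_def by metis
    then show ?thesis
      using xy le_refl
      by (simp add: fun_eq_iff bracket_matrix_unit(1)[OF L_closed[OF xy(1)]]
          bracket_matrix_unit(2)[OF L_closed[OF xy(2)]])
  qed
  define b where "b = (\<lambda>u v. if v \<in> X then L (?E v v) u v else 0)"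
  show b: "b \<in> A"
    using incidence_zero[OF L_closed] by (auto simp: b_def incidence_algebra_def)
  show "L (?E x x) u v = bracket b (?E x x) u v" if x: "x \<in> X" and "u \<noteq> v"
    for x u v
  proof (cases "u \<in> X \<and> v \<in> X")
    case True
    have rhs: "bracket b (?E x x) u v = (if v = x then b u x else 0) - (if u = x then b x v else 0)"
      using x le_refl by (simp add: bracket_matrix_unit[OF b])
    consider "v = x" | "u = x" | "u \<noteq> x" "v \<noteq> x" by blast
    then show ?thesis
    proof cases
      case 1
      then show ?thesis using rhs x \<open>u \<noteq> v\<close> by (simp add: b_def)
    next
      case 2
      then have "L (?E x x) x v = - L (?E v v) x v"
        using commute[of x v v x] True \<open>u \<noteq> v\<close> by (simp add: eq_neg_iff_add_eq_0)
      then show ?thesis using rhs 2 True \<open>u \<noteq> v\<close> by (simp add: b_def)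
    next
      case 3
      then have "L (?E x x) u v = 0"
        using commute[of u x v u] True x \<open>u \<noteq> v\<close> by simp
      then show ?thesis using rhs 3 by simp
    qed
  next
    case False
    then show ?thesis
      using incidence_zero[OF L_closed[OF x], of u v]
        incidence_zero[OF bracket_closed[OF b closed[OF x]], of u v] by auto
  qed
qed

end

theorem theorem2p1:
  fixes X :: "'a set" and le :: "'a \<Rightarrow> 'a \<Rightarrow> bool"
    and L :: "('a \<Rightarrow> 'a \<Rightarrow> 'r::{comm_ring, comm_monoid_mult}) \<Rightarrow> ('a \<Rightarrow> 'a \<Rightarrow> 'r)"
  assumes two_torsion_free: "\<And>r::'r. r + r = 0 \<Longrightarrow> r = 0"
    and "finite X"
    and "reflp_on X le"
    and "transp_on X le"
    and "lie_derivation (incidence_algebra X le) incidence_scale (incidence_mult X le) L"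
  shows "proper_lie_derivation (incidence_algebra X le) incidence_scale (incidence_mult X le) L"
proof -
  interpret finite_preorder X le
    using assms by unfold_locales
  obtain b where b: "b \<in> A"
    and off: "\<And>x u v. x \<in> X \<Longrightarrow> u \<noteq> v \<Longrightarrow>
      L (matrix_unit x x) u v = bracket b (matrix_unit x x) u v"
    using diagonalizing_inner_derivation[OF assms(5)] by blast
  interpret reduced: diagonal_lie_derivation X le "\<lambda>f. L f - bracket b f"
  proof
    show "r = 0" if "r + r = 0" for r :: 'r by (rule two_torsion_free[OF that])
  qed (use lie_derivation_diff[OF assms(5) derivation_inner[OF b]] off in auto)
  let ?D = "\<lambda>f. bracket b f + hadamard reduced.weight f"
  let ?F = "\<lambda>f. L f - ?D f"
  have D: "derivation A incidence_scale (incidence_mult X le) ?D"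
    by (intro derivation_add derivation_inner b derivation_hadamard reduced.weight_cocycle)
  have "linear_endo A incidence_scale ?F"
    using D assms(5) by (intro linear_endo_diff) (auto simp: derivation_def lie_derivation_def)
  moreover have "?F f \<in> algebra_center A (incidence_mult X le)" if "f \<in> A" for f
    using reduced.L_minus_hadamard_central[OF that] by (simp add: diff_diff_eq)
  moreover have "L f = ?D f + ?F f" for f by simp
  ultimately show ?thesis
    unfolding proper_lie_derivation_def using assms(5) D by blast
qed

end
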